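(* Let $Q$ be a quandle. Then $Q$ is latin if and only if there exists $x\in Q$ such that the left multiplication $L_x:Q\to Q$ is bijective.
   Context: A quandle is a non-empty set $Q$ with a binary operation $*$ such that: (Q1) $x*x=x$ for all $x$; (Q2) for all $x,y\in Q$ there is a unique $z\in Q$ with $x=z*y$; (Q3) $(x*y)*z=(x*z)*(y*z)$ for all $x,y,z$. For $x\in Q$, the left multiplication $L_x:Q\to Q$ is $L_x(y)=x*y$. The quandle $Q$ is latin if $L_x$ is a bijection for every $x\in Q$. *)

theory Defs
  imports Main
begin

locale quandle =
  fixes Q :: "'a set"
    and qmult :: "'a \<Rightarrow> 'a \<Rightarrow> 'a"  (infixl "\<star>" 70)
  assumes nonempty: "Q \<noteq> {}"
    and closed: "\<And>x y. x \<in> Q \<Longrightarrow> y \<in> Q \<Longrightarrow> x \<star> y \<in> Q"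
    and idem: "\<And>x. x \<in> Q \<Longrightarrow> x \<star> x = x"
    and right_div: "\<And>x y. x \<in> Q \<Longrightarrow> y \<in> Q \<Longrightarrow> \<exists>!z. z \<in> Q \<and> x = z \<star> y"
    and right_distrib:
      "\<And>x y z. x \<in> Q \<Longrightarrow> y \<in> Q \<Longrightarrow> z \<in> Q \<Longrightarrow> (x \<star> y) \<star> z = (x \<star> z) \<star> (y \<star> z)"

definition left_mult :: "('a \<Rightarrow> 'a \<Rightarrow> 'a) \<Rightarrow> 'a \<Rightarrow> 'a \<Rightarrow> 'a" where
  "left_mult f x = (\<lambda>y. f x y)"

locale latin_quandle = quandle +
  assumes left_mult_bij: "\<And>x. x \<in> Q \<Longrightarrow> bij_betw (left_mult qmult x) Q Q"

end

theory Submission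
  imports Defs
begin

text \<open>
  Right multiplications are automorphisms of a quandle, and an automorphism \<open>\<phi>\<close> conjugates \<open>L\<^sub>x\<close>
  into the left multiplication by \<open>\<phi> x\<close>.  So bijectivity of \<open>L\<^sub>x\<close> depends only on the orbit of \<open>x\<close>
  under right multiplications.  If \<open>L\<^sub>x\<close> is bijective then, already by its surjectivity, every
  element has the form \<open>x \<star> y\<close>; the orbit of \<open>x\<close> is the whole quandle, and every left
  multiplication is bijective.
\<close>

context quandle
begin

lemma right_mult_bij:
  assumes "y \<in> Q"
  shows "bij_betw (\<lambda>z. z \<star> y) Q Q"
  unfolding bij_betw_def
proof
  show "inj_on (\<lambda>z. z \<star> y) Q"
  proof (rule inj_onI)
    fix u v assume "u \<in> Q" "v \<in> Q" "u \<star> y = v \<star> y"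
    then show "u = v"
      using right_div[OF closed[OF \<open>u \<in> Q\<close> assms] assms] by metis
  qed
  show "(\<lambda>z. z \<star> y) ` Q = Q"
  proof
    show "(\<lambda>z. z \<star> y) ` Q \<subseteq> Q"
      using closed[OF _ assms] by (rule image_subsetI)
    show "Q \<subseteq> (\<lambda>z. z \<star> y) ` Q"
    proof
      fix x assume "x \<in> Q"
      then obtain z where "z \<in> Q" "x = z \<star> y"
        using ex1_implies_ex[OF right_div[OF _ assms]] by iprover
      then show "x \<in> (\<lambda>z. z \<star> y) ` Q" by (rule rev_image_eqI)
    qed
  qed
qed

text \<open>
  Right distributivity is the intertwining relation \<open>L\<^bsub>x \<star> y\<^esub> \<circ> R\<^sub>y = R\<^sub>y \<circ> L\<^sub>x\<close> on \<open>Q\<close>, and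
  \<open>R\<^sub>y\<close>, the right multiplication by \<open>y\<close>, can be cancelled because it is bijective.
\<close>

lemma left_mult_bij_translate:
  assumes "x \<in> Q" "y \<in> Q" "bij_betw (left_mult qmult x) Q Q"
  shows "bij_betw (left_mult qmult (x \<star> y)) Q Q"
proof -
  have "((\<lambda>z. z \<star> y) \<circ> left_mult qmult x) w
      = (left_mult qmult (x \<star> y) \<circ> (\<lambda>z. z \<star> y)) w" if "w \<in> Q" for w
    using right_distrib[OF assms(1) that assms(2)] by (simp add: left_mult_def)
  note intertwine = bij_betw_cong[OF this, where A' = Q]
  have "bij_betw ((\<lambda>z. z \<star> y) \<circ> left_mult qmult x) Q Q"
    using assms(3) right_mult_bij[OF assms(2)] by (rule bij_betw_trans)
  then have "bij_betw (left_mult qmult (x \<star> y) \<circ> (\<lambda>z. z \<star> y)) Q Q"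
    by (rule intertwine[THEN iffD1, rotated])
  then show ?thesis
    by (rule bij_betw_comp_iff[OF right_mult_bij[OF assms(2)], THEN iffD2])
qed

end

theorem theorem2p1:
  fixes Q :: "'a set"
    and qmult :: "'a \<Rightarrow> 'a \<Rightarrow> 'a"
  assumes "quandle Q qmult"
  shows "latin_quandle Q qmult \<longleftrightarrow> (\<exists>x\<in>Q. bij_betw (left_mult qmult x) Q Q)"
proof
  assume "latin_quandle Q qmult"
  then show "\<exists>x\<in>Q. bij_betw (left_mult qmult x) Q Q"
    using quandle.nonempty[OF assms] latin_quandle.left_mult_bij by (metis ex_in_conv)
next
  interpret quandle Q qmult by (rule assms)
  assume "\<exists>x\<in>Q. bij_betw (left_mult qmult x) Q Q"
  then obtain x where x: "x \<in> Q" "bij_betw (left_mult qmult x) Q Q" by blast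
  show "latin_quandle Q qmult"
  proof
    fix z assume "z \<in> Q"
    then obtain y where "y \<in> Q" "z = qmult x y"
      using bij_betw_imp_surj_on[OF x(2)] by (auto simp: left_mult_def)
    then show "bij_betw (left_mult qmult z) Q Q"
      using left_mult_bij_translate[OF x(1) _ x(2)] by simp
  qed
qed

end
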